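(* There is a translation $T:\mathcal{L}_{\mathsf{MISL}}\to\mathcal{L}_{\mathsf{ML}^\infty}$ such that for every formula $\varphi\in\mathcal{L}_{\mathsf{MISL}}$, every model $M$ and every state $s$ of $M$, $$M,s\vDash_{\mathsf{MISL}}\varphi\quad\text{iff}\quad M,s\vDash_{\mathsf{ML}^\infty}T(\varphi).$$
   Context: $\mathcal{L}_{\mathsf{MISL}}$: $\varphi::=p\mid\neg\varphi\mid\varphi\land\varphi\mid\Diamond\varphi\mid\langle p:=\varphi\rangle\varphi\mid\langle(p:=\varphi)^*\rangle\varphi$, with $p$ from a countable set $\mathbf{P}$ of letters. A model is $M=(W,R,V)$ with $W\ne\emptyset$, $R\subseteq W\times W$, $V:\mathbf{P}\to2^W$. Truth: letters, Booleans and $\Diamond$ (along $R$) as usual; $M,w\vDash\langle p:=\psi\rangle\varphi$ iff $M|_{p:=\psi},w\vDash\varphi$, where $M|_{p:=\psi}$ is $M$ with the value of $p$ changed to $\{v\in W:M,v\vDash\psi\}$; $M,w\vDash\langle(p:=\psi)^*\rangle\varphi$ iff $M|_{(p:=\psi)^n},w\vDash\varphi$ for some $n\in\mathbb{N}$, where $M|_{(p:=\psi)^0}=M$ and $M|_{(p:=\psi)^{n+1}}=(M|_{(p:=\psi)^n})|_{p:=\psi}$. $\mathsf{ML}^\infty$ is the infinitary modal logic extending the standard modal logic (letters, $\neg,\land,\Diamond$) with countable conjunctions $\bigwedge_{i\in I}\varphi_i$ and countable disjunctions $\bigvee_{i\in I}\varphi_i$ ($I$ countable), interpreted on the same models in the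 obvious way. *)

theory Defs
  imports Main "HOL-Library.Countable"
begin

datatype 'p misl =
    Letter 'p
  | Neg "'p misl"
  | Conj "'p misl" "'p misl"
  | Dia "'p misl"
  | Assign 'p "'p misl" "'p misl"
  | AssignStar 'p "'p misl" "'p misl"

text \<open>
  A countable family of formulas is given by an index set \<open>I \<subseteq> \<nat>\<close> (finite, empty or infinite)
  and a function on the natural numbers whose values outside \<open>I\<close> are irrelevant.
\<close>

datatype 'p mlinf =
    ILetter 'p
  | INeg "'p mlinf"
  | IConj "'p mlinf" "'p mlinf"
  | IDia "'p mlinf"
  | IBigConj "nat set" "nat \<Rightarrow> 'p mlinf"
  | IBigDisj "nat set" "nat \<Rightarrow> 'p mlinf"

record ('w, 'p) model =
  worlds :: "'w set"
  rel :: "('w \<times> 'w) set"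
  val :: "'p \<Rightarrow> 'w set"

definition is_model :: "('w, 'p) model \<Rightarrow> bool" where
  "is_model M \<longleftrightarrow>
     worlds M \<noteq> {} \<and> rel M \<subseteq> worlds M \<times> worlds M \<and> (\<forall>p. val M p \<subseteq> worlds M)"

definition set_val :: "('w, 'p) model \<Rightarrow> 'p \<Rightarrow> 'w set \<Rightarrow> ('w, 'p) model" where
  "set_val M p X = M\<lparr>val := (val M)(p := X)\<rparr>"

primrec misl_sat :: "('w, 'p) model \<Rightarrow> 'w \<Rightarrow> 'p misl \<Rightarrow> bool" where
  "misl_sat M w (Letter p) \<longleftrightarrow> w \<in> val M p"
| "misl_sat M w (Neg \<phi>) \<longleftrightarrow> \<not> misl_sat M w \<phi>"
| "misl_sat M w (Conj \<phi> \<psi>) \<longleftrightarrow> misl_sat M w \<phi> \<and> misl_sat M w \<psi>"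
| "misl_sat M w (Dia \<phi>) \<longleftrightarrow> (\<exists>v. (w, v) \<in> rel M \<and> misl_sat M v \<phi>)"
| "misl_sat M w (Assign p \<psi> \<phi>) \<longleftrightarrow>
     misl_sat (set_val M p {v \<in> worlds M. misl_sat M v \<psi>}) w \<phi>"
| "misl_sat M w (AssignStar p \<psi> \<phi>) \<longleftrightarrow>
     (\<exists>n. misl_sat (((\<lambda>N. set_val N p {v \<in> worlds N. misl_sat N v \<psi>}) ^^ n) M) w \<phi>)"

primrec mlinf_sat :: "('w, 'p) model \<Rightarrow> 'w \<Rightarrow> 'p mlinf \<Rightarrow> bool" where
  "mlinf_sat M w (ILetter p) \<longleftrightarrow> w \<in> val M p"
| "mlinf_sat M w (INeg \<phi>) \<longleftrightarrow> \<not> mlinf_sat M w \<phi>"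
| "mlinf_sat M w (IConj \<phi> \<psi>) \<longleftrightarrow> mlinf_sat M w \<phi> \<and> mlinf_sat M w \<psi>"
| "mlinf_sat M w (IDia \<phi>) \<longleftrightarrow> (\<exists>v. (w, v) \<in> rel M \<and> mlinf_sat M v \<phi>)"
| "mlinf_sat M w (IBigConj I \<Phi>) \<longleftrightarrow> (\<forall>i\<in>I. mlinf_sat M w (\<Phi> i))"
| "mlinf_sat M w (IBigDisj I \<Phi>) \<longleftrightarrow> (\<exists>i\<in>I. mlinf_sat M w (\<Phi> i))"

primrec mlinf_subst :: "'p \<Rightarrow> 'p mlinf \<Rightarrow> 'p mlinf \<Rightarrow> 'p mlinf" where
  "mlinf_subst p \<chi> (ILetter q) = (if q = p then \<chi> else ILetter q)"
| "mlinf_subst p \<chi> (INeg \<phi>) = INeg (mlinf_subst p \<chi> \<phi>)"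
| "mlinf_subst p \<chi> (IConj \<phi> \<psi>) = IConj (mlinf_subst p \<chi> \<phi>) (mlinf_subst p \<chi> \<psi>)"
| "mlinf_subst p \<chi> (IDia \<phi>) = IDia (mlinf_subst p \<chi> \<phi>)"
| "mlinf_subst p \<chi> (IBigConj I \<Phi>) = IBigConj I (\<lambda>i. mlinf_subst p \<chi> (\<Phi> i))"
| "mlinf_subst p \<chi> (IBigDisj I \<Phi>) = IBigDisj I (\<lambda>i. mlinf_subst p \<chi> (\<Phi> i))"

text \<open>
  The translation is a constant rather than an existentially bound variable because HOL cannot
  quantify over the type of worlds below an existential quantifier: in a formula
  \<open>\<exists>T. \<forall>\<phi> M s. \<dots>\<close> the witness could depend on that type, whereas a single translation has to
  serve all models. The recursion for \<open>AssignStar\<close> may substitute into the translation of the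
  continuation, since being true after \<open>n + 1\<close> updates means that
  \<open>mlinf_subst p (misl_trans \<psi>)\<close> of the formula is true after \<open>n\<close> updates.
\<close>

primrec misl_trans :: "'p misl \<Rightarrow> 'p mlinf" where
  "misl_trans (Letter p) = ILetter p"
| "misl_trans (Neg \<phi>) = INeg (misl_trans \<phi>)"
| "misl_trans (Conj \<phi> \<psi>) = IConj (misl_trans \<phi>) (misl_trans \<psi>)"
| "misl_trans (Dia \<phi>) = IDia (misl_trans \<phi>)"
| "misl_trans (Assign p \<psi> \<phi>) = mlinf_subst p (misl_trans \<psi>) (misl_trans \<phi>)"
| "misl_trans (AssignStar p \<psi> \<phi>) =
     IBigDisj UNIV (\<lambda>n. (mlinf_subst p (misl_trans \<psi>) ^^ n) (misl_trans \<phi>))"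

end

theory Submission
  imports Defs
begin

text \<open>
  An assignment \<open>p := \<psi>\<close> changes the model only at the letter \<open>p\<close>, and infinitary modal formulas
  contain no binders, so changing the value of \<open>p\<close> to the truth set of \<open>\<chi>\<close> amounts to substituting
  \<open>\<chi>\<close> for \<open>p\<close> (\<open>mlinf_sat_subst\<close>).  An iterated assignment is a disjunction over the number of
  rounds, and \<open>n\<close> rounds amount to \<open>n\<close> substitutions (\<open>mlinf_sat_subst_funpow\<close>): although each round
  reads \<open>\<chi>\<close> in the model produced by the previous round, repeated substitution into the continuation
  reproduces this, because the outermost substitution is the one evaluated in the original model.

  The theorem follows by induction on the formula, with the model kept arbitrary since the assignment
  cases pass to updated models.  Updates preserve \<open>is_model\<close>, and every state reached by
  \<open>\<Diamond>\<close> stays among the worlds; the latter matters because the new value of \<open>p\<close>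
  contains worlds only.
\<close>

lemma worlds_set_val [simp]: "worlds (set_val M p X) = worlds M"
  and rel_set_val [simp]: "rel (set_val M p X) = rel M"
  and val_set_val [simp]: "val (set_val M p X) = (val M)(p := X)"
  by (simp_all add: set_val_def)

lemma is_model_set_val:
  assumes "is_model M" and "X \<subseteq> worlds M"
  shows "is_model (set_val M p X)"
  using assms by (simp add: is_model_def)

lemma is_model_rel_target:
  assumes "is_model M" and "(w, v) \<in> rel M"
  shows "v \<in> worlds M"
  using assms by (auto simp: is_model_def)

abbreviation mlinf_update :: "'p \<Rightarrow> 'p mlinf \<Rightarrow> ('w, 'p) model \<Rightarrow> ('w, 'p) model" where
  "mlinf_update p \<chi> M \<equiv> set_val M p {v \<in> worlds M. mlinf_sat M v \<chi>}"

text \<open>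
  Restricting to worlds is essential at the letter \<open>p\<close>: outside \<open>worlds M\<close> the updated \<open>p\<close> is false
  whatever \<open>\<chi>\<close> says.  The diamond case stays inside by \<open>is_model_rel_target\<close>.
\<close>

lemma mlinf_sat_subst:
  assumes "is_model M" and "w \<in> worlds M"
  shows "mlinf_sat M w (mlinf_subst p \<chi> \<phi>) \<longleftrightarrow> mlinf_sat (mlinf_update p \<chi> M) w \<phi>"
  using assms(2)
proof (induction \<phi> arbitrary: w)
  case (IDia \<phi>)
  then show ?case
    using is_model_rel_target[OF assms(1)] by auto
qed auto

text \<open>
  Peeling the outermost substitution off replaces \<open>M\<close> by its first update, so the remaining \<open>n\<close>
  substitutions are read there; the induction therefore needs \<open>M\<close> arbitrary, and the updates are
  matched by moving the first one innermost.
\<close>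

lemma mlinf_sat_subst_funpow:
  assumes "is_model M" and "w \<in> worlds M"
  shows "mlinf_sat M w ((mlinf_subst p \<chi> ^^ n) \<phi>) \<longleftrightarrow> mlinf_sat ((mlinf_update p \<chi> ^^ n) M) w \<phi>"
  using assms
proof (induction n arbitrary: M)
  case (Suc n)
  have "mlinf_sat M w ((mlinf_subst p \<chi> ^^ Suc n) \<phi>)
      \<longleftrightarrow> mlinf_sat (mlinf_update p \<chi> M) w ((mlinf_subst p \<chi> ^^ n) \<phi>)"
    using Suc.prems by (simp add: mlinf_sat_subst)
  also have "\<dots> \<longleftrightarrow> mlinf_sat ((mlinf_update p \<chi> ^^ n) (mlinf_update p \<chi> M)) w \<phi>"
    using Suc.prems by (intro Suc.IH is_model_set_val) auto
  also have "\<dots> \<longleftrightarrow> mlinf_sat ((mlinf_update p \<chi> ^^ Suc n) M) w \<phi>"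
    by (simp only: funpow_Suc_right o_apply)
  finally show ?case .
qed simp

lemma is_model_funpow_update:
  assumes "is_model M"
  shows "is_model ((mlinf_update p \<chi> ^^ n) M) \<and> worlds ((mlinf_update p \<chi> ^^ n) M) = worlds M"
  using assms by (induction n) (auto intro!: is_model_set_val)

abbreviation misl_update :: "'p \<Rightarrow> 'p misl \<Rightarrow> ('w, 'p) model \<Rightarrow> ('w, 'p) model" where
  "misl_update p \<psi> M \<equiv> set_val M p {v \<in> worlds M. misl_sat M v \<psi>}"

text \<open>
  Agreement of \<open>\<psi>\<close> and \<open>\<chi>\<close> is assumed on all models, not just on \<open>M\<close>, because from the second
  round on the truth sets are computed in the updated models.
\<close>

lemma misl_update_funpow_eq:
  fixes M :: "('w, 'p) model"
  assumes agree: "\<And>(N :: ('w, 'p) model) v.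
      is_model N \<Longrightarrow> v \<in> worlds N \<Longrightarrow> misl_sat N v \<psi> \<longleftrightarrow> mlinf_sat N v \<chi>"
    and "is_model M"
  shows "(misl_update p \<psi> ^^ n) M = (mlinf_update p \<chi> ^^ n) M"
proof (induction n)
  case (Suc n)
  let ?N = "(mlinf_update p \<chi> ^^ n) M"
  have "misl_update p \<psi> ?N = mlinf_update p \<chi> ?N"
    using agree is_model_funpow_update[OF assms(2)] by (metis (no_types, lifting))
  then show ?case
    using Suc.IH by simp
qed simp

theorem theorem5p4:
  fixes \<phi> :: "'p::countable misl"
    and M :: "('w, 'p) model"
    and s :: 'w
  assumes "is_model M" and "s \<in> worlds M"
  shows "misl_sat M s \<phi> \<longleftrightarrow> mlinf_sat M s (misl_trans \<phi>)"
  using assms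
proof (induction \<phi> arbitrary: M s)
  case (Dia \<phi>)
  then show ?case
    using is_model_rel_target[OF Dia.prems(1)] by auto
next
  case (Assign p \<psi> \<phi>)
  have "misl_update p \<psi> M = mlinf_update p (misl_trans \<psi>) M"
    using misl_update_funpow_eq[OF Assign.IH(1) Assign.prems(1), where n = 1] by simp
  moreover have "is_model (mlinf_update p (misl_trans \<psi>) M)"
    using Assign.prems(1) by (auto intro: is_model_set_val)
  ultimately show ?case
    using Assign.prems Assign.IH(2) by (simp add: mlinf_sat_subst)
next
  case (AssignStar p \<psi> \<phi>)
  have "misl_sat ((misl_update p \<psi> ^^ n) M) s \<phi>
      \<longleftrightarrow> mlinf_sat M s ((mlinf_subst p (misl_trans \<psi>) ^^ n) (misl_trans \<phi>))" for n
    using AssignStar.prems AssignStar.IH(2) is_model_funpow_update[OF AssignStar.prems(1)]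
    by (simp add: misl_update_funpow_eq[OF AssignStar.IH(1)] mlinf_sat_subst_funpow)
  then show ?case
    by simp
qed simp_all

end
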